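(* For every shifted skew shape $\lambda/\mu$, the function $Q_{\lambda/\mu}(x_1,x_2,\ldots)$ is symmetric in the variables $x_i$.
   Context: A strict partition is a strictly decreasing finite sequence $\lambda=(\lambda_1>\cdots>\lambda_k)$ of positive integers (possibly empty); its shifted diagram is the set of boxes $(r,c)$ (row $r$ counted from the top, column $c$ from the left) with $1\le r\le k$ and $r\le c\le r+\lambda_r-1$. A shifted skew shape $\lambda/\mu$ is the difference of two such diagrams, with $\mu$ contained in $\lambda$. Let $\mathrm{ShST}_Q(\lambda/\mu)$ be the set of fillings $T$ of the boxes of $\lambda/\mu$ by letters from $1'<1<2'<2<3'<3<\cdots$ that are weakly increasing along rows (left to right) and down columns, with no primed letter repeated in a row and no unprimed letter repeated in a column. Let $\mathrm{wt}(T)=(n_1,n_2,\ldots)$, where $n_i$ is the number of boxes of $T$ containing $i$ or $i'$. The Schur $Q$-function is the formal power series $Q_{\lambda/\mu}(x_1,x_2,\ldots)=\sum_{T\in\mathrm{ShST}_Q(\lambda/\mu)}x^{\mathrm{wt}(T)}$, where $x^\alpha=x_1^{\alpha_1}x_2^{\alpha_2}\cdots$. *)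

theory Defs
  imports
    "HOL-Library.FuncSet"
    "HOL-Library.Poly_Mapping"
    "HOL-Combinatorics.Permutations"
begin

definition strict_partition :: "nat list \<Rightarrow> bool" where
  "strict_partition lam \<longleftrightarrow> sorted_wrt (>) lam \<and> (\<forall>p\<in>set lam. 0 < p)"

text \<open>Boxes are pairs (row, column), counted from 1; the part in row \<open>r\<close> is \<open>lam ! (r - 1)\<close>.\<close>

definition shifted_diagram :: "nat list \<Rightarrow> (nat \<times> nat) set" where
  "shifted_diagram lam =
     {(r, c). 1 \<le> r \<and> r \<le> length lam \<and> r \<le> c \<and> c \<le> r + lam ! (r - 1) - 1}"

definition shifted_skew_shape :: "nat list \<Rightarrow> nat list \<Rightarrow> bool" where
  "shifted_skew_shape lam mu \<longleftrightarrow>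
     strict_partition lam \<and> strict_partition mu \<and> shifted_diagram mu \<subseteq> shifted_diagram lam"

definition skew_boxes :: "nat list \<Rightarrow> nat list \<Rightarrow> (nat \<times> nat) set" where
  "skew_boxes lam mu = shifted_diagram lam - shifted_diagram mu"

datatype letter =
  is_Primed: Primed (letter_index: nat)
| is_Unprimed: Unprimed (letter_index: nat)

text \<open>The order \<open>1' < 1 < 2' < 2 < \<dots>\<close> is pulled back from the natural numbers.\<close>

fun letter_rank :: "letter \<Rightarrow> nat" where
  "letter_rank (Primed i) = 2 * i"
| "letter_rank (Unprimed i) = 2 * i + 1"

lemma letter_rank_eq_iff: "letter_rank a = letter_rank b \<longleftrightarrow> a = b"
  by (cases a; cases b; simp; presburger)

instantiation letter :: linorder
begin

definition less_eq_letter :: "letter \<Rightarrow> letter \<Rightarrow> bool" where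
  "a \<le> b \<longleftrightarrow> letter_rank a \<le> letter_rank b"

definition less_letter :: "letter \<Rightarrow> letter \<Rightarrow> bool" where
  "a < b \<longleftrightarrow> letter_rank a < letter_rank b"

instance
  by standard (auto simp: less_eq_letter_def less_letter_def simp flip: letter_rank_eq_iff)

end

definition letters :: "letter set" where
  "letters = {a. 1 \<le> letter_index a}"

text \<open>Fillings are extensional functions, so that each one is counted exactly once.\<close>

definition ShST_Q :: "nat list \<Rightarrow> nat list \<Rightarrow> (nat \<times> nat \<Rightarrow> letter) set" where
  "ShST_Q lam mu =
     {T \<in> skew_boxes lam mu \<rightarrow>\<^sub>E letters.
        (\<forall>r c d. (r, c) \<in> skew_boxes lam mu \<and> (r, d) \<in> skew_boxes lam mu \<and> c < d \<longrightarrow>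
           T (r, c) \<le> T (r, d) \<and> \<not> (T (r, c) = T (r, d) \<and> is_Primed (T (r, c)))) \<and>
        (\<forall>r s c. (r, c) \<in> skew_boxes lam mu \<and> (s, c) \<in> skew_boxes lam mu \<and> r < s \<longrightarrow>
           T (r, c) \<le> T (s, c) \<and> \<not> (T (r, c) = T (s, c) \<and> is_Unprimed (T (r, c))))}"

definition wt :: "(nat \<times> nat) set \<Rightarrow> (nat \<times> nat \<Rightarrow> letter) \<Rightarrow> nat \<Rightarrow> nat" where
  "wt D T i = card {b \<in> D. letter_index (T b) = i}"

text \<open>
  A formal power series with integer coefficients is given by its coefficient function on
  monomials; a monomial \<open>x\<^sup>\<alpha>\<close> is its finitely supported exponent vector \<open>\<alpha>\<close>.
  The variables are \<open>x\<^sub>1, x\<^sub>2, \<dots>\<close>; the index 0 is not used, so no monomial of \<open>schur_Q\<close>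
  below involves it.
\<close>

type_synonym series = "(nat \<Rightarrow>\<^sub>0 nat) \<Rightarrow> int"

definition schur_Q :: "nat list \<Rightarrow> nat list \<Rightarrow> series" where
  "schur_Q lam mu \<alpha> =
     int (card {T \<in> ShST_Q lam mu. wt (skew_boxes lam mu) T = Poly_Mapping.lookup \<alpha>})"

text \<open>
  The series \<open>f(x\<^bsub>\<sigma>(1)\<^esub>, x\<^bsub>\<sigma>(2)\<^esub>, \<dots>)\<close>: the substitution sends \<open>x\<^sup>\<alpha>\<close> to \<open>x\<^sup>\<beta>\<close> with
  \<open>\<alpha> = \<beta> \<circ> \<sigma>\<close>, which is \<open>map_key \<sigma> \<beta>\<close> for injective \<open>\<sigma>\<close>.
\<close>

definition permute_variables :: "(nat \<Rightarrow> nat) \<Rightarrow> series \<Rightarrow> series" where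
  "permute_variables \<sigma> f = (\<lambda>\<beta>. f (Poly_Mapping.map_key \<sigma> \<beta>))"

definition symmetric_series :: "series \<Rightarrow> bool" where
  "symmetric_series f \<longleftrightarrow> (\<forall>\<sigma>. \<sigma> permutes {1..} \<longrightarrow> permute_variables \<sigma> f = f)"

text \<open>The cardinality in \<open>schur_Q\<close> is always that of a finite set.\<close>

lemma finite_shifted_diagram: "finite (shifted_diagram lam)"
proof -
  have "shifted_diagram lam \<subseteq> (SIGMA r:{..length lam}. {..r + lam ! (r - 1) - 1})"
    by (auto simp: shifted_diagram_def)
  then show ?thesis
    by (rule finite_subset) auto
qed

lemma finite_skew_boxes: "finite (skew_boxes lam mu)"
  by (simp add: skew_boxes_def finite_shifted_diagram)

lemma finite_ShST_Q_wt:
  "finite {T \<in> ShST_Q lam mu. wt (skew_boxes lam mu) T = Poly_Mapping.lookup \<alpha>}"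
proof -
  let ?D = "skew_boxes lam mu"
  let ?L = "Primed ` Poly_Mapping.keys \<alpha> \<union> Unprimed ` Poly_Mapping.keys \<alpha>"
  have "T \<in> ?D \<rightarrow>\<^sub>E ?L" if T: "T \<in> ShST_Q lam mu" "wt ?D T = Poly_Mapping.lookup \<alpha>" for T
  proof (rule PiE_I)
    fix b assume b: "b \<in> ?D"
    have "finite {b' \<in> ?D. letter_index (T b') = letter_index (T b)}"
      using finite_skew_boxes[of lam mu] by simp
    moreover have "{b' \<in> ?D. letter_index (T b') = letter_index (T b)} \<noteq> {}"
      using b by blast
    ultimately have "wt ?D T (letter_index (T b)) \<noteq> 0"
      unfolding wt_def by (simp only: card_eq_0_iff) simp
    then have "letter_index (T b) \<in> Poly_Mapping.keys \<alpha>"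
      using T(2) by (simp add: in_keys_iff)
    then show "T b \<in> ?L" by (cases "T b") auto
  next
    fix b assume "b \<notin> ?D"
    moreover have "T \<in> ?D \<rightarrow>\<^sub>E letters" using T(1) by (simp add: ShST_Q_def)
    ultimately show "T b = undefined" by (rule PiE_arb[rotated])
  qed
  then have "{T \<in> ShST_Q lam mu. wt ?D T = Poly_Mapping.lookup \<alpha>} \<subseteq> ?D \<rightarrow>\<^sub>E ?L" by blast
  then show ?thesis
    by (rule finite_subset) (intro finite_PiE finite_skew_boxes; simp)
qed

end

theory Submission
  imports Defs "HOL-Computational_Algebra.Polynomial"
begin

text \<open>
  The proof shows that the numbers of tableaux of weight \<open>\<alpha>\<close> and of weight \<open>\<alpha>\<close> with
  the entries at \<open>i\<close> and \<open>i + 1\<close> exchanged agree. In a tableau the boxes containing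
  \<open>i'\<close>, \<open>i\<close>, \<open>(i + 1)'\<close> or \<open>i + 1\<close> form a convex region of the staircase
  \<open>r \<le> c\<close>, and this region can be refilled with these four letters independently of the rest
  (\<open>tableau_override\<close>). So it suffices to prove, for a finite convex set of boxes, that the
  generating function of its fillings with two letters, of weights \<open>x\<close> and \<open>y\<close>, is
  symmetric (\<open>pair_gf_symmetric\<close>).

  For this the set is swept along its diagonals \<open>c - r = 0, 1, 2, \<dots>\<close>. Indices increase
  strictly along a diagonal, so with two letters a diagonal has at most two boxes. If it has two, they
  carry the two letters in a fixed order, and the diagonal contributes a constant multiple of
  \<open>x y\<close>. If it has one box, the choice of its letter depends on the
  previous diagonal only, and the sweep is a product of \<open>2 \<times> 2\<close> transfer matrices. Writing
  \<open>(p, q)\<close> for the generating functions with the smaller and the larger letter in the last box,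
  and letting a new letter count twice (primed or unprimed), a step to the right sends \<open>(p, q)\<close>
  to \<open>(x p, 2 y p + y q)\<close> and a step upwards sends it to \<open>(x p + 2 x q, y q)\<close>. Both steps
  preserve the pair of relations
  \<open>p + q = p~ + q~\<close> and \<open>(x + y) (p - p~) = (x - y) (p + q)\<close>,
  where the tilde exchanges \<open>x\<close> and \<open>y\<close>. The starting vector \<open>(2 x, 2 y)\<close> satisfies them,
  and so does \<open>(x, y)\<close>, to which a single box after a diagonal with two boxes leads. The first
  relation is the symmetry. The second plays the part of a Yang--Baxter relation: it determines
  \<open>(p~, q~)\<close> linearly from \<open>(p, q)\<close> by a matrix that intertwines the two orders of the variables.

  Transpositions of neighbours generate all finite permutations, and an arbitrary permutation of the
  variables acts on a given monomial like a finite one.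
\<close>

section \<open>Tableaux as a nearest-neighbour condition\<close>

definition row_ok :: "letter \<Rightarrow> letter \<Rightarrow> bool" where
  "row_ok l m \<longleftrightarrow> l \<le> m \<and> \<not> (l = m \<and> is_Primed l)"

definition col_ok :: "letter \<Rightarrow> letter \<Rightarrow> bool" where
  "col_ok l m \<longleftrightarrow> l \<le> m \<and> \<not> (l = m \<and> is_Unprimed l)"

text \<open>
  Besides skew shapes, the regions occupied by two consecutive letters occur as domains of tableaux;
  what both have in common is convexity in the staircase \<open>r \<le> c\<close>.
\<close>

definition tableau :: "(nat \<times> nat) set \<Rightarrow> (nat \<times> nat \<Rightarrow> letter) \<Rightarrow> bool" where
  "tableau A T \<longleftrightarrow>
     (\<forall>r c d. (r, c) \<in> A \<and> (r, d) \<in> A \<and> c < d \<longrightarrow> row_ok (T (r, c)) (T (r, d))) \<and>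
     (\<forall>r s c. (r, c) \<in> A \<and> (s, c) \<in> A \<and> r < s \<longrightarrow> col_ok (T (r, c)) (T (s, c)))"

text \<open>
  In this form a tableau can be built diagonal by diagonal, since only adjacent boxes constrain
  each other. The last clause follows from the first two when the box \<open>(r, Suc c)\<close> lies in the
  set, but not in the partial shapes that occur during the construction, where that box has not been
  added yet. Recording it beforehand prevents dead ends.
\<close>

definition local_tableau :: "(nat \<times> nat) set \<Rightarrow> (nat \<times> nat \<Rightarrow> letter) \<Rightarrow> bool" where
  "local_tableau A T \<longleftrightarrow>
     (\<forall>r c. (r, c) \<in> A \<and> (r, Suc c) \<in> A \<longrightarrow> row_ok (T (r, c)) (T (r, Suc c))) \<and>
     (\<forall>r c. (r, c) \<in> A \<and> (Suc r, c) \<in> A \<longrightarrow> col_ok (T (r, c)) (T (Suc r, c))) \<and>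
     (\<forall>r c. (r, c) \<in> A \<and> (Suc r, Suc c) \<in> A \<longrightarrow>
        letter_index (T (r, c)) < letter_index (T (Suc r, Suc c)))"

definition shifted_convex :: "(nat \<times> nat) set \<Rightarrow> bool" where
  "shifted_convex A \<longleftrightarrow>
     (\<forall>r c. (r, c) \<in> A \<longrightarrow> r \<le> c) \<and>
     (\<forall>r c r' c' r'' c''. (r, c) \<in> A \<and> (r'', c'') \<in> A \<and> r \<le> r' \<and> r' \<le> r'' \<and>
        c \<le> c' \<and> c' \<le> c'' \<and> r' \<le> c' \<longrightarrow> (r', c') \<in> A)"

lemma shifted_convexD:
  assumes "shifted_convex A" "(r, c) \<in> A" "(r'', c'') \<in> A"
    "r \<le> r'" "r' \<le> r''" "c \<le> c'" "c' \<le> c''" "r' \<le> c'"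
  shows "(r', c') \<in> A"
  using assms unfolding shifted_convex_def by blast

lemma shifted_convex_staircase: "shifted_convex A \<Longrightarrow> (r, c) \<in> A \<Longrightarrow> r \<le> c"
  unfolding shifted_convex_def by blast

lemma row_ok_trans: "row_ok a b \<Longrightarrow> row_ok b c \<Longrightarrow> row_ok a c"
  unfolding row_ok_def by auto

lemma col_ok_trans: "col_ok a b \<Longrightarrow> col_ok b c \<Longrightarrow> col_ok a c"
  unfolding col_ok_def by (metis order_antisym order_trans)

lemma less_letter_index: "letter_index a < letter_index b \<Longrightarrow> a < b"
  by (cases a; cases b) (auto simp: less_letter_def)

lemma letter_index_mono: "a \<le> b \<Longrightarrow> letter_index a \<le> letter_index b"
  by (cases a; cases b) (auto simp: less_eq_letter_def)

lemma row_ok_index_less: "letter_index a < letter_index b \<Longrightarrow> row_ok a b"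
  using less_letter_index[of a b] by (auto simp: row_ok_def)

lemma col_ok_index_less: "letter_index a < letter_index b \<Longrightarrow> col_ok a b"
  using less_letter_index[of a b] by (auto simp: col_ok_def)

lemma row_ok_simps [simp]:
  "row_ok (Primed i) (Primed j) \<longleftrightarrow> i < j"
  "row_ok (Primed i) (Unprimed j) \<longleftrightarrow> i \<le> j"
  "row_ok (Unprimed i) (Primed j) \<longleftrightarrow> i < j"
  "row_ok (Unprimed i) (Unprimed j) \<longleftrightarrow> i \<le> j"
  by (auto simp: row_ok_def less_eq_letter_def)

lemma col_ok_simps [simp]:
  "col_ok (Primed i) (Primed j) \<longleftrightarrow> i \<le> j"
  "col_ok (Primed i) (Unprimed j) \<longleftrightarrow> i \<le> j"
  "col_ok (Unprimed i) (Primed j) \<longleftrightarrow> i < j"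
  "col_ok (Unprimed i) (Unprimed j) \<longleftrightarrow> i < j"
  by (auto simp: col_ok_def less_eq_letter_def)

text \<open>
  With equal indices the middle letter would have to be unprimed, by the row condition, and
  primed, by the column condition.
\<close>

lemma row_col_index_less:
  assumes "row_ok a b" "col_ok b c"
  shows "letter_index a < letter_index c"
  using assms by (cases a; cases b; cases c) auto

lemma tableau_imp_local_tableau:
  assumes A: "shifted_convex A" and T: "tableau A T"
  shows "local_tableau A T"
  unfolding local_tableau_def
proof (intro conjI allI impI; elim conjE)
  fix r c assume b: "(r, c) \<in> A" "(Suc r, Suc c) \<in> A"
  have "(r, Suc c) \<in> A"
    using shifted_convexD[OF A b, of r "Suc c"] shifted_convex_staircase[OF A b(1)] by simp
  then have "row_ok (T (r, c)) (T (r, Suc c))" "col_ok (T (r, Suc c)) (T (Suc r, Suc c))"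
    using T b unfolding tableau_def by (meson lessI)+
  then show "letter_index (T (r, c)) < letter_index (T (Suc r, Suc c))"
    by (rule row_col_index_less)
qed (use T in \<open>auto simp: tableau_def\<close>)

lemma local_tableau_imp_tableau:
  assumes A: "shifted_convex A" and T: "local_tableau A T"
  shows "tableau A T"
  unfolding tableau_def
proof (intro conjI allI impI; elim conjE)
  fix r c d assume b: "(r, c) \<in> A" "(r, d) \<in> A" "c < d"
  have "row_ok (T (r, c)) (T (r, Suc c + k))" if "(r, Suc c + k) \<in> A" for k
    using that
  proof (induction k)
    case 0
    then show ?case using T b(1) by (simp add: local_tableau_def)
  next
    case (Suc k)
    have "(r, Suc c + k) \<in> A"
      using shifted_convexD[OF A b(1) Suc.prems, of r "Suc c + k"]
        shifted_convex_staircase[OF A b(1)] by simp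
    with Suc T show ?case
      using row_ok_trans by (fastforce simp: local_tableau_def)
  qed
  from this[of "d - Suc c"] b show "row_ok (T (r, c)) (T (r, d))" by simp
next
  fix r s c assume b: "(r, c) \<in> A" "(s, c) \<in> A" "r < s"
  have "col_ok (T (r, c)) (T (Suc r + k, c))" if "(Suc r + k, c) \<in> A" for k
    using that
  proof (induction k)
    case 0
    then show ?case using T b(1) by (simp add: local_tableau_def)
  next
    case (Suc k)
    have "(Suc r + k, c) \<in> A"
      using shifted_convexD[OF A b(1) Suc.prems, of "Suc r + k" c]
        shifted_convex_staircase[OF A Suc.prems] by simp
    with Suc T show ?case
      using col_ok_trans by (fastforce simp: local_tableau_def)
  qed
  from this[of "s - Suc r"] b show "col_ok (T (r, c)) (T (s, c))" by simp
qed

text \<open>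
  The alphabet of the two consecutive letters \<open>i\<close> and \<open>Suc i\<close>, primed or not, whose
  multiplicities are to be exchanged.
\<close>

definition pair_letters :: "nat \<Rightarrow> letter set" where
  "pair_letters i = {l. letter_index l = i \<or> letter_index l = Suc i}"

lemma pair_letters_eq:
  "pair_letters i = {Primed i, Unprimed i, Primed (Suc i), Unprimed (Suc i)}"
  unfolding pair_letters_def by (auto simp: letter.expand) (metis letter.exhaust_sel)+

definition fillings :: "nat \<Rightarrow> (nat \<times> nat) set \<Rightarrow> (nat \<times> nat \<Rightarrow> letter) set" where
  "fillings i A = {T \<in> A \<rightarrow>\<^sub>E pair_letters i. local_tableau A T}"

lemma finite_fillings: "finite A \<Longrightarrow> finite (fillings i A)"
  unfolding fillings_def pair_letters_eq by (auto intro!: finite_PiE)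

text \<open>
  A box added before the boxes to its right, above it, and diagonally below it is constrained only
  by its left neighbour, its lower neighbour and the preceding box of its own diagonal.
\<close>

lemma local_tableau_insert:
  assumes "(r, c) \<notin> A" "(r, Suc c) \<notin> A" "(Suc r, Suc c) \<notin> A"
    "\<And>r'. r = Suc r' \<Longrightarrow> (r', c) \<notin> A"
  shows "local_tableau (insert (r, c) A) (T((r, c) := l)) \<longleftrightarrow> local_tableau A T \<and>
    (\<forall>c'. c = Suc c' \<and> (r, c') \<in> A \<longrightarrow> row_ok (T (r, c')) l) \<and>
    ((Suc r, c) \<in> A \<longrightarrow> col_ok l (T (Suc r, c))) \<and>
    (\<forall>r' c'. r = Suc r' \<and> c = Suc c' \<and> (r', c') \<in> A \<longrightarrow>
       letter_index (T (r', c')) < letter_index l)"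
proof -
  let ?A = "insert (r, c) A" and ?T = "T((r, c) := l)"
  have row: "(\<forall>x y. (x, y) \<in> ?A \<and> (x, Suc y) \<in> ?A \<longrightarrow> row_ok (?T (x, y)) (?T (x, Suc y))) \<longleftrightarrow>
    (\<forall>x y. (x, y) \<in> A \<and> (x, Suc y) \<in> A \<longrightarrow> row_ok (T (x, y)) (T (x, Suc y))) \<and>
    (\<forall>c'. c = Suc c' \<and> (r, c') \<in> A \<longrightarrow> row_ok (T (r, c')) l)" (is "?L \<longleftrightarrow> ?R")
  proof
    assume L: ?L
    show ?R
    proof (intro conjI allI impI; elim conjE)
      fix x y assume "(x, y) \<in> A" "(x, Suc y) \<in> A"
      with spec[OF spec[OF L], of x y] assms(1) show "row_ok (T (x, y)) (T (x, Suc y))"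
        by (auto split: if_splits)
    next
      fix c' assume "c = Suc c'" "(r, c') \<in> A"
      with spec[OF spec[OF L], of r c'] show "row_ok (T (r, c')) l" by simp
    qed
  qed (use assms(1,2) in auto)
  have col: "(\<forall>x y. (x, y) \<in> ?A \<and> (Suc x, y) \<in> ?A \<longrightarrow> col_ok (?T (x, y)) (?T (Suc x, y))) \<longleftrightarrow>
    (\<forall>x y. (x, y) \<in> A \<and> (Suc x, y) \<in> A \<longrightarrow> col_ok (T (x, y)) (T (Suc x, y))) \<and>
    ((Suc r, c) \<in> A \<longrightarrow> col_ok l (T (Suc r, c)))" (is "?L \<longleftrightarrow> ?R")
  proof
    assume L: ?L
    show ?R
    proof (intro conjI allI impI; (elim conjE)?)
      fix x y assume "(x, y) \<in> A" "(Suc x, y) \<in> A"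
      with spec[OF spec[OF L], of x y] assms(1) show "col_ok (T (x, y)) (T (Suc x, y))"
        by (auto split: if_splits)
    next
      assume "(Suc r, c) \<in> A"
      with spec[OF spec[OF L], of r c] show "col_ok l (T (Suc r, c))" by simp
    qed
  qed (use assms(1,4) in auto)
  have diag: "(\<forall>x y. (x, y) \<in> ?A \<and> (Suc x, Suc y) \<in> ?A \<longrightarrow>
      letter_index (?T (x, y)) < letter_index (?T (Suc x, Suc y))) \<longleftrightarrow>
    (\<forall>x y. (x, y) \<in> A \<and> (Suc x, Suc y) \<in> A \<longrightarrow>
      letter_index (T (x, y)) < letter_index (T (Suc x, Suc y))) \<and>
    (\<forall>r' c'. r = Suc r' \<and> c = Suc c' \<and> (r', c') \<in> A \<longrightarrow>
       letter_index (T (r', c')) < letter_index l)" (is "?L \<longleftrightarrow> ?R")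
  proof
    assume L: ?L
    show ?R
    proof (intro conjI allI impI; elim conjE)
      fix x y assume "(x, y) \<in> A" "(Suc x, Suc y) \<in> A"
      with spec[OF spec[OF L], of x y] assms(1)
      show "letter_index (T (x, y)) < letter_index (T (Suc x, Suc y))"
        by (auto split: if_splits)
    next
      fix r' c' assume "r = Suc r'" "c = Suc c'" "(r', c') \<in> A"
      with spec[OF spec[OF L], of r' c'] show "letter_index (T (r', c')) < letter_index l" by simp
    qed
  qed (use assms(1,3) in auto)
  show ?thesis
    unfolding local_tableau_def row col diag by blast
qed

lemma sum_fillings_insert:
  fixes g :: "(nat \<times> nat \<Rightarrow> letter) \<Rightarrow> 'a :: comm_monoid_add"
  assumes "finite A" "b \<notin> A"
  shows "(\<Sum>T\<in>fillings i (insert b A). g T) =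
    (\<Sum>T\<in>fillings i A. \<Sum>l\<in>pair_letters i.
       if local_tableau (insert b A) (T(b := l)) then g (T(b := l)) else 0)"
proof -
  let ?upd = "\<lambda>p :: (nat \<times> nat \<Rightarrow> letter) \<times> letter. (fst p)(b := snd p)"
  let ?X = "{p \<in> fillings i A \<times> pair_letters i. local_tableau (insert b A) (?upd p)}"
  have restr: "local_tableau A T" if "local_tableau (insert b A) (T(b := l))" for T l
    using that assms(2) unfolding local_tableau_def by (auto split: if_splits)
  have "fillings i (insert b A) = ?upd ` ?X"
  proof (intro equalityI subsetI)
    fix T assume "T \<in> fillings i (insert b A)"
    then obtain l U where "l \<in> pair_letters i" "U \<in> A \<rightarrow>\<^sub>E pair_letters i" "T = U(b := l)"
      and "local_tableau (insert b A) T"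
      unfolding fillings_def PiE_insert_eq by auto
    then have "(U, l) \<in> ?X" "T = ?upd (U, l)"
      using restr by (auto simp: fillings_def)
    then show "T \<in> ?upd ` ?X" by (rule rev_image_eqI)
  next
    fix T assume "T \<in> ?upd ` ?X"
    then obtain U l where "U \<in> A \<rightarrow>\<^sub>E pair_letters i" "l \<in> pair_letters i" "T = U(b := l)"
      "local_tableau (insert b A) T"
      by (auto simp: fillings_def)
    then show "T \<in> fillings i (insert b A)"
      by (simp add: fillings_def fun_upd_in_PiE PiE_fun_upd)
  qed
  moreover have "inj_on ?upd ?X"
  proof (rule inj_onI)
    fix p q assume p: "p \<in> ?X" and q: "q \<in> ?X" and eq: "?upd p = ?upd q"
    have "fst p b = undefined" "fst q b = undefined"
      using p q assms(2) by (auto simp: fillings_def)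
    with eq show "p = q" by (metis fun_upd_same fun_upd_triv fun_upd_upd prod.expand)
  qed
  ultimately have "(\<Sum>T\<in>fillings i (insert b A). g T) = (\<Sum>p\<in>?X. g (?upd p))"
    by (simp add: sum.reindex)
  also have "\<dots> = (\<Sum>p\<in>fillings i A \<times> pair_letters i.
      if local_tableau (insert b A) (?upd p) then g (?upd p) else 0)"
    by (rule sum.inter_filter)
      (use finite_fillings[OF assms(1)] in \<open>simp add: pair_letters_eq\<close>)
  finally show ?thesis by (simp add: sum.cartesian_product case_prod_unfold)
qed

section \<open>Generating functions over two letters\<close>

definition letter_weight :: "nat \<Rightarrow> 'a \<Rightarrow> 'a \<Rightarrow> letter \<Rightarrow> 'a" where
  "letter_weight i x y l = (if letter_index l = i then x else y)"

definition weight :: "nat \<Rightarrow> 'a \<Rightarrow> 'a \<Rightarrow> (nat \<times> nat) set \<Rightarrow> (nat \<times> nat \<Rightarrow> letter) \<Rightarrow> 'a :: comm_ring_1"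
  where "weight i x y A T = (\<Prod>b\<in>A. letter_weight i x y (T b))"

definition pair_gf :: "nat \<Rightarrow> 'a \<Rightarrow> 'a \<Rightarrow> (nat \<times> nat) set \<Rightarrow> 'a :: comm_ring_1" where
  "pair_gf i x y A = (\<Sum>T\<in>fillings i A. weight i x y A T)"

text \<open>
  The part of the generating function in which the box \<open>b\<close> carries the smaller of the
  two letters; the remaining part belongs to the fillings in which \<open>b\<close> carries the larger one.
\<close>

definition pair_gf_at :: "nat \<Rightarrow> 'a \<Rightarrow> 'a \<Rightarrow> (nat \<times> nat) set \<Rightarrow> nat \<times> nat \<Rightarrow> 'a :: comm_ring_1" where
  "pair_gf_at i x y A b = (\<Sum>T\<in>fillings i A. if letter_index (T b) = i then weight i x y A T else 0)"

text \<open>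
  The difference \<open>c - r\<close> numbers the diagonals of the staircase, so \<open>beyond\<close> says that
  all boxes of \<open>A\<close> lie on earlier diagonals than \<open>(r, c)\<close>. Boxes are added in this order.
\<close>

definition beyond :: "(nat \<times> nat) set \<Rightarrow> nat \<Rightarrow> nat \<Rightarrow> bool" where
  "beyond A r c \<longleftrightarrow> r \<le> c \<and> (\<forall>r' c'. (r', c') \<in> A \<longrightarrow> r' \<le> c' \<and> c' - r' < c - r)"

definition step_ok :: "(nat \<times> nat) set \<Rightarrow> (nat \<times> nat \<Rightarrow> letter) \<Rightarrow> nat \<Rightarrow> nat \<Rightarrow> letter \<Rightarrow> bool" where
  "step_ok A T r c l \<longleftrightarrow>
     (\<forall>c'. c = Suc c' \<and> (r, c') \<in> A \<longrightarrow> row_ok (T (r, c')) l) \<and>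
     ((Suc r, c) \<in> A \<longrightarrow> col_ok l (T (Suc r, c)))"

lemma beyond_notin:
  assumes "beyond A r c"
  shows "(r, c) \<notin> A" "(r, Suc c) \<notin> A" "(Suc r, Suc c) \<notin> A" "r = Suc r' \<Longrightarrow> (r', c) \<notin> A"
    "r = Suc r' \<Longrightarrow> c = Suc c' \<Longrightarrow> (r', c') \<notin> A"
  using assms unfolding beyond_def by fastforce+

lemma beyond_diagonal: "beyond A r c \<Longrightarrow> beyond A (Suc r) (Suc c)"
  unfolding beyond_def by simp

lemma local_tableau_insert_beyond:
  assumes "beyond A r c"
  shows "local_tableau (insert (r, c) A) (T((r, c) := l)) \<longleftrightarrow> local_tableau A T \<and> step_ok A T r c l"
  using beyond_notin[OF assms] unfolding step_ok_def
  by (subst local_tableau_insert) auto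

text \<open>
  Two consecutive boxes of one diagonal restrict each other only through the strict increase of
  their indices; otherwise both see just the shape \<open>A\<close> that was there before.
\<close>

lemma local_tableau_insert_diagonal:
  assumes "beyond A r c"
  shows "local_tableau (insert (Suc r, Suc c) (insert (r, c) A)) (T((r, c) := l, (Suc r, Suc c) := m))
    \<longleftrightarrow> local_tableau A T \<and> step_ok A T r c l \<and> step_ok A T (Suc r) (Suc c) m \<and>
      letter_index l < letter_index m"
  using beyond_notin[OF beyond_diagonal[OF assms]]
  by (subst local_tableau_insert)
    (auto simp: local_tableau_insert_beyond[OF assms] step_ok_def)

lemma weight_insert:
  assumes "finite A" "b \<notin> A"
  shows "weight i x y (insert b A) (T(b := l)) = letter_weight i x y l * weight i x y A T"
proof -
  have "(\<Prod>a\<in>A. letter_weight i x y ((T(b := l)) a)) = (\<Prod>a\<in>A. letter_weight i x y (T a))"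
    using assms(2) by (intro prod.cong) auto
  then show ?thesis using assms by (simp add: weight_def)
qed

lemma sum_pair_letters:
  "(\<Sum>l\<in>pair_letters i. h l) =
    h (Primed i) + h (Unprimed i) + h (Primed (Suc i)) + h (Unprimed (Suc i))"
  by (simp add: pair_letters_eq add.assoc)

lemma fillings_local: "T \<in> fillings i A \<Longrightarrow> local_tableau A T"
  by (simp add: fillings_def)

lemma fillings_cases:
  assumes "T \<in> fillings i A" "b \<in> A"
  obtains "T b = Primed i" | "T b = Unprimed i" | "T b = Primed (Suc i)" | "T b = Unprimed (Suc i)"
  using assms by (auto simp: fillings_def pair_letters_eq dest!: PiE_mem)

lemma pair_gf_insert:
  assumes "finite A" "beyond A r c"
  shows "pair_gf i x y (insert (r, c) A) = (\<Sum>T\<in>fillings i A. weight i x y A T *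
    (\<Sum>l\<in>pair_letters i. if step_ok A T r c l then letter_weight i x y l else 0))"
  unfolding pair_gf_def sum_fillings_insert[OF assms(1) beyond_notin(1)[OF assms(2)]]
  by (intro sum.cong refl)
    (auto simp: local_tableau_insert_beyond[OF assms(2)] fillings_local sum_distrib_left
      weight_insert[OF assms(1) beyond_notin(1)[OF assms(2)]] intro!: sum.cong)

lemma pair_gf_at_insert:
  assumes "finite A" "beyond A r c"
  shows "pair_gf_at i x y (insert (r, c) A) (r, c) = (\<Sum>T\<in>fillings i A. weight i x y A T *
    (\<Sum>l\<in>pair_letters i. if step_ok A T r c l \<and> letter_index l = i then x else 0))"
  unfolding pair_gf_at_def sum_fillings_insert[OF assms(1) beyond_notin(1)[OF assms(2)]]
  by (intro sum.cong refl)
    (auto simp: local_tableau_insert_beyond[OF assms(2)] fillings_local sum_distrib_left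
      letter_weight_def
      weight_insert[OF assms(1) beyond_notin(1)[OF assms(2)]] intro!: sum.cong)

text \<open>
  The two new boxes must carry \<open>i\<close> and \<open>Suc i\<close> in this order, so each of their
  fillings has weight \<open>x * y\<close>, and only the number \<open>k\<close> of ways to place the primes remains.
\<close>

lemma pair_gf_insert_diagonal:
  assumes "finite A" "beyond A r c"
    and k: "\<And>T. T \<in> fillings i A \<Longrightarrow>
      (\<Sum>l\<in>pair_letters i. \<Sum>m\<in>pair_letters i.
         if step_ok A T r c l \<and> step_ok A T (Suc r) (Suc c) m \<and> letter_index l < letter_index m
         then x * y else 0) = k * (x * y)"
  shows "pair_gf i x y (insert (Suc r, Suc c) (insert (r, c) A)) = k * (x * y) * pair_gf i x y A"
proof -
  have b: "(r, c) \<notin> A" "(Suc r, Suc c) \<notin> insert (r, c) A"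
    using beyond_notin[OF assms(2)] by auto
  have "pair_gf i x y (insert (Suc r, Suc c) (insert (r, c) A)) =
    (\<Sum>T\<in>fillings i A. \<Sum>l\<in>pair_letters i. if local_tableau (insert (r, c) A) (T((r, c) := l)) then
       \<Sum>m\<in>pair_letters i. if local_tableau (insert (Suc r, Suc c) (insert (r, c) A))
           (T((r, c) := l, (Suc r, Suc c) := m))
       then letter_weight i x y m * (letter_weight i x y l * weight i x y A T) else 0 else 0)"
    using assms(1) b by (simp add: pair_gf_def sum_fillings_insert weight_insert cong: if_cong)
  also have "\<dots> = (\<Sum>T\<in>fillings i A. weight i x y A T * 
      (\<Sum>l\<in>pair_letters i. \<Sum>m\<in>pair_letters i.
         if step_ok A T r c l \<and> step_ok A T (Suc r) (Suc c) m \<and> letter_index l < letter_index m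
         then x * y else 0))"
    unfolding sum_distrib_left local_tableau_insert_beyond[OF assms(2)]
      local_tableau_insert_diagonal[OF assms(2)]
    by (intro sum.cong refl)
      (auto simp: fillings_local letter_weight_def pair_letters_def mult_ac intro!: sum.cong)
  also have "\<dots> = k * (x * y) * pair_gf i x y A"
    by (simp add: k pair_gf_def sum_distrib_left mult.commute)
  finally show ?thesis .
qed


section \<open>Adding the boxes of one diagonal\<close>

text \<open>
  A box without neighbours can carry each of the four letters.
\<close>

lemma pair_gf_insert_free:
  assumes "finite A" "beyond A r c" "\<And>c'. c = Suc c' \<Longrightarrow> (r, c') \<notin> A" "(Suc r, c) \<notin> A"
  shows "pair_gf i x y (insert (r, c) A) = 2 * (x + y) * pair_gf i x y A"
    and "pair_gf_at i x y (insert (r, c) A) (r, c) = 2 * x * pair_gf i x y A"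
proof -
  have ok: "step_ok A T r c l" for T l
    using assms(3,4) by (auto simp: step_ok_def)
  show "pair_gf i x y (insert (r, c) A) = 2 * (x + y) * pair_gf i x y A"
    "pair_gf_at i x y (insert (r, c) A) (r, c) = 2 * x * pair_gf i x y A"
    unfolding pair_gf_insert[OF assms(1,2)] pair_gf_at_insert[OF assms(1,2)]
    unfolding pair_gf_def sum_distrib_left
    by (intro sum.cong refl, simp add: ok sum_pair_letters letter_weight_def algebra_simps)+
qed

text \<open>
  To the right of an \<open>i\<close> the letter \<open>i\<close> must be unprimed and \<open>Suc i\<close> is free; to the
  right of a \<open>Suc i\<close> only the unprimed \<open>Suc i\<close> fits.
\<close>

lemma pair_gf_insert_right:
  assumes "finite A" "beyond A r (Suc c)" "(r, c) \<in> A" "(Suc r, Suc c) \<notin> A"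
  shows "pair_gf i x y (insert (r, Suc c) A) = (x + y) * pair_gf_at i x y A (r, c) + y * pair_gf i x y A"
    and "pair_gf_at i x y (insert (r, Suc c) A) (r, Suc c) = x * pair_gf_at i x y A (r, c)"
proof -
  have ok: "step_ok A T r (Suc c) l \<longleftrightarrow> row_ok (T (r, c)) l" for T l
    using assms(3,4) by (auto simp: step_ok_def)
  show "pair_gf i x y (insert (r, Suc c) A) = (x + y) * pair_gf_at i x y A (r, c) + y * pair_gf i x y A"
    unfolding pair_gf_insert[OF assms(1,2)]
    unfolding pair_gf_def pair_gf_at_def sum_distrib_left sum.distrib[symmetric]
    by (intro sum.cong refl, erule fillings_cases[OF _ assms(3)])
      (simp_all add: ok sum_pair_letters letter_weight_def algebra_simps)
  show "pair_gf_at i x y (insert (r, Suc c) A) (r, Suc c) = x * pair_gf_at i x y A (r, c)"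
    unfolding pair_gf_at_insert[OF assms(1,2)]
    unfolding pair_gf_at_def sum_distrib_left sum.distrib[symmetric]
    by (intro sum.cong refl, erule fillings_cases[OF _ assms(3)])
      (simp_all add: ok sum_pair_letters letter_weight_def algebra_simps)
qed

text \<open>
  The transposed rule: above an \<open>i\<close> only the primed \<open>i\<close> fits; above a \<open>Suc i\<close> the
  letter \<open>i\<close> is free and \<open>Suc i\<close> must be primed.
\<close>

lemma pair_gf_insert_up:
  assumes "finite A" "beyond A r c" "\<And>c'. c = Suc c' \<Longrightarrow> (r, c') \<notin> A" "(Suc r, c) \<in> A"
  shows "pair_gf i x y (insert (r, c) A) = (2 * x + y) * pair_gf i x y A - (x + y) * pair_gf_at i x y A (Suc r, c)"
    and "pair_gf_at i x y (insert (r, c) A) (r, c) = 2 * x * pair_gf i x y A - x * pair_gf_at i x y A (Suc r, c)"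
proof -
  have ok: "step_ok A T r c l \<longleftrightarrow> col_ok l (T (Suc r, c))" for T l
    using assms(3,4) by (auto simp: step_ok_def)
  show "pair_gf i x y (insert (r, c) A) = (2 * x + y) * pair_gf i x y A - (x + y) * pair_gf_at i x y A (Suc r, c)"
    unfolding pair_gf_insert[OF assms(1,2)]
    unfolding pair_gf_def pair_gf_at_def sum_distrib_left sum_subtractf[symmetric]
    by (intro sum.cong refl, erule fillings_cases[OF _ assms(4)])
      (simp_all add: ok sum_pair_letters letter_weight_def algebra_simps)
  show "pair_gf_at i x y (insert (r, c) A) (r, c) = 2 * x * pair_gf i x y A - x * pair_gf_at i x y A (Suc r, c)"
    unfolding pair_gf_at_insert[OF assms(1,2)]
    unfolding pair_gf_def pair_gf_at_def sum_distrib_left sum_subtractf[symmetric]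
    by (intro sum.cong refl, erule fillings_cases[OF _ assms(4)])
      (simp_all add: ok sum_pair_letters letter_weight_def algebra_simps)
qed

lemma fillings_diagonal:
  assumes "T \<in> fillings i A" "(r, c) \<in> A" "(Suc r, Suc c) \<in> A"
  shows "T (r, c) = Primed i \<or> T (r, c) = Unprimed i"
    and "T (Suc r, Suc c) = Primed (Suc i) \<or> T (Suc r, Suc c) = Unprimed (Suc i)"
proof -
  have "letter_index (T (r, c)) < letter_index (T (Suc r, Suc c))"
    using fillings_local[OF assms(1)] assms(2,3) by (simp add: local_tableau_def)
  then show "T (r, c) = Primed i \<or> T (r, c) = Unprimed i"
    "T (Suc r, Suc c) = Primed (Suc i) \<or> T (Suc r, Suc c) = Unprimed (Suc i)"
    using fillings_cases[OF assms(1,2)] fillings_cases[OF assms(1,3)]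
    by (metis lessI letter.sel less_irrefl not_less_iff_gr_or_eq)+
qed

text \<open>
  Indices increase strictly along a diagonal, and only two are available.
\<close>

lemma fillings_three_boxes:
  assumes "(r, c) \<in> A" "(Suc r, Suc c) \<in> A" "(Suc (Suc r), Suc (Suc c)) \<in> A"
  shows "fillings i A = {}"
  using fillings_diagonal(2)[OF _ assms(1,2)] fillings_diagonal(1)[OF _ assms(2,3)] by fastforce

text \<open>
  The left and the lower neighbour lie on one diagonal, so they carry \<open>i\<close> and \<open>Suc i\<close>.
  Hence only the unprimed \<open>i\<close> and the primed \<open>Suc i\<close> fit.
\<close>

lemma pair_gf_insert_corner:
  assumes "finite A" "beyond A r (Suc c)" "(r, c) \<in> A" "(Suc r, Suc c) \<in> A"
  shows "pair_gf i x y (insert (r, Suc c) A) = (x + y) * pair_gf i x y A"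
    and "pair_gf_at i x y (insert (r, Suc c) A) (r, Suc c) = x * pair_gf i x y A"
proof -
  have ok: "step_ok A T r (Suc c) l \<longleftrightarrow> row_ok (T (r, c)) l \<and> col_ok l (T (Suc r, Suc c))" for T l
    using assms(3,4) by (auto simp: step_ok_def)
  have forced: "step_ok A T r (Suc c) (Primed i) = False" "step_ok A T r (Suc c) (Unprimed i) = True"
    "step_ok A T r (Suc c) (Primed (Suc i)) = True" "step_ok A T r (Suc c) (Unprimed (Suc i)) = False"
    if T: "T \<in> fillings i A" for T
    using fillings_diagonal[OF T assms(3,4)] by (auto simp: ok)
  show "pair_gf i x y (insert (r, Suc c) A) = (x + y) * pair_gf i x y A"
    "pair_gf_at i x y (insert (r, Suc c) A) (r, Suc c) = x * pair_gf i x y A"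
    unfolding pair_gf_insert[OF assms(1,2)] pair_gf_at_insert[OF assms(1,2)]
    unfolding pair_gf_def sum_distrib_left
    by (intro sum.cong refl, simp add: forced sum_pair_letters letter_weight_def algebra_simps)+
qed

text \<open>
  The box \<open>(Suc r, c)\<close> between the two new ones is the lower neighbour of the first and the left
  neighbour of the second. Whichever of the two letters it carries, it fixes the prime of the new box
  with the same letter and leaves the other one free. A further box on the previous diagonal fixes
  that one as well. So the number of choices is the same for all fillings of \<open>A\<close>.
\<close>

lemma pair_gf_insert_two_boxes:
  assumes fin: "finite A" and bey: "beyond A r c" and M: "r < c \<Longrightarrow> (Suc r, c) \<in> A"
  shows "\<exists>k. \<forall>x y :: 'a :: comm_ring_1.
    pair_gf i x y (insert (Suc r, Suc c) (insert (r, c) A)) = k * (x * y) * pair_gf i x y A"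
proof -
  let ?S = "\<lambda>x y T. \<Sum>l\<in>pair_letters i. \<Sum>m\<in>pair_letters i.
    if step_ok A T r c l \<and> step_ok A T (Suc r) (Suc c) m \<and> letter_index l < letter_index m
    then x * y else (0 :: 'a)"
  have "\<exists>k. \<forall>T\<in>fillings i A. \<forall>x y. ?S x y T = k * (x * y)"
  proof (cases "r < c")
    case False
    with bey have "A = {}"
      by (auto simp: beyond_def)
    then have "step_ok A T r' c' l" for T r' c' l
      by (simp add: step_ok_def)
    then show ?thesis
      \<comment> \<open>No diagonal precedes the main one, so both primes are free.\<close>
      by (intro exI[of _ 4]) (simp add: sum_pair_letters)
  next
    case True
    then obtain d where c: "c = Suc d" by (cases c) auto
    have M: "(Suc r, Suc d) \<in> A" using M[OF True] c by simp
    have step1: "step_ok A T r c l \<longleftrightarrow>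
        ((r, d) \<in> A \<longrightarrow> row_ok (T (r, d)) l) \<and> col_ok l (T (Suc r, Suc d))" for T l
      using M by (auto simp: step_ok_def c)
    have step2: "step_ok A T (Suc r) (Suc c) m \<longleftrightarrow>
        row_ok (T (Suc r, Suc d)) m \<and>
        ((Suc (Suc r), Suc (Suc d)) \<in> A \<longrightarrow> col_ok m (T (Suc (Suc r), Suc (Suc d))))" for T m
      using M by (auto simp: step_ok_def c)
    show ?thesis
    proof (cases "(r, d) \<in> A"; cases "(Suc (Suc r), Suc (Suc d)) \<in> A")
      assume L: "(r, d) \<in> A" and B: "(Suc (Suc r), Suc (Suc d)) \<in> A"
      have "fillings i A = {}" by (rule fillings_three_boxes[OF L M B])
      then show ?thesis by simp
    next
      assume L: "(r, d) \<in> A" and B: "(Suc (Suc r), Suc (Suc d)) \<notin> A"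
      have "?S x y T = 1 * (x * y)" if T: "T \<in> fillings i A" for T x y
        using fillings_diagonal[OF T L M] L B by (auto simp: step1 step2 sum_pair_letters)
      then show ?thesis by blast
    next
      assume L: "(r, d) \<notin> A" and B: "(Suc (Suc r), Suc (Suc d)) \<in> A"
      have "?S x y T = 1 * (x * y)" if T: "T \<in> fillings i A" for T x y
        using fillings_diagonal[OF T M B] L B by (auto simp: step1 step2 sum_pair_letters)
      then show ?thesis by blast
    next
      assume L: "(r, d) \<notin> A" and B: "(Suc (Suc r), Suc (Suc d)) \<notin> A"
      have "?S x y T = 2 * (x * y)" if T: "T \<in> fillings i A" for T x y
        by (rule fillings_cases[OF T M]) (use L B in \<open>auto simp: step1 step2 sum_pair_letters\<close>)
      then show ?thesis by blast
    qed
  qed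
  then obtain k where "?S x y T = k * (x * y)" if "T \<in> fillings i A" for T x y
    by blast
  then show ?thesis
    using pair_gf_insert_diagonal[OF fin bey] by blast
qed

section \<open>The invariant of the diagonal sweep\<close>

text \<open>
  Symmetry of the generating function alone does not survive the addition of a box; this is what has
  to be known in addition about the distribution of the letter in the last box. If that box is alone
  on its diagonal, let \<open>p\<close> and \<open>q\<close> be the parts of the generating function with the smaller
  and the larger letter in it, and write \<open>p~\<close> for \<open>p\<close> with \<open>x\<close> and \<open>y\<close> exchanged. The
  relation says \<open>(x + y) (p - p~) = (x - y) (p + q)\<close>. It holds for an isolated box, where \<open>p\<close>
  and \<open>q\<close> are in the ratio \<open>x : y\<close>, and it is preserved by both kinds of steps to an adjacent
  single box.
\<close>

definition balanced :: "nat \<Rightarrow> 'a :: comm_ring_1 \<Rightarrow> 'a \<Rightarrow> (nat \<times> nat) set \<Rightarrow> nat \<times> nat \<Rightarrow> bool" where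
  "balanced i x y A b \<longleftrightarrow>
     (x + y) * (pair_gf_at i x y A b - pair_gf_at i y x A b) = (x - y) * pair_gf i x y A"

text \<open>
  In this lemma and the next one \<open>s\<close> is the generating function of the shape so far, \<open>p\<close> its
  part with the smaller letter in the last box, and \<open>q\<close> is \<open>p\<close> with the variables exchanged. The
  conclusions are symmetry and balance after the step.
\<close>

lemma right_step_algebra:
  fixes x y :: "'a :: comm_ring_1"
  assumes "(x + y) * (p - q) = (x - y) * s"
  shows "(x + y) * p + y * s = (y + x) * q + x * s"
    and "(x + y) * (x * p - y * q) = (x - y) * ((x + y) * p + y * s)"
proof -
  have q: "(x + y) * q = (x + y) * p - (x - y) * s"
    using assms by (simp add: algebra_simps)
  then show "(x + y) * p + y * s = (y + x) * q + x * s"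
    by (simp add: add.commute[of y x]) (simp add: algebra_simps)
  have "(x + y) * (x * p - y * q) = x * ((x + y) * p) - y * ((x + y) * q)"
    by (simp add: algebra_simps)
  also have "\<dots> = (x - y) * ((x + y) * p + y * s)"
    unfolding q by (simp add: algebra_simps)
  finally show "(x + y) * (x * p - y * q) = (x - y) * ((x + y) * p + y * s)" .
qed

lemma up_step_algebra:
  fixes x y :: "'a :: comm_ring_1"
  assumes "(x + y) * (p - q) = (x - y) * s"
  shows "(2 * x + y) * s - (x + y) * p = (2 * y + x) * s - (y + x) * q"
    and "(x + y) * ((2 * x * s - x * p) - (2 * y * s - y * q)) =
      (x - y) * ((2 * x + y) * s - (x + y) * p)"
proof -
  have q: "(x + y) * q = (x + y) * p - (x - y) * s"
    using assms by (simp add: algebra_simps)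
  then show "(2 * x + y) * s - (x + y) * p = (2 * y + x) * s - (y + x) * q"
    by (simp add: add.commute[of y x]) (simp add: algebra_simps)
  have "(x + y) * ((2 * x * s - x * p) - (2 * y * s - y * q)) =
      2 * (x + y) * (x - y) * s - x * ((x + y) * p) + y * ((x + y) * q)"
    by (simp add: algebra_simps)
  also have "\<dots> = (x - y) * ((2 * x + y) * s - (x + y) * p)"
    unfolding q by (simp add: algebra_simps)
  finally show "(x + y) * ((2 * x * s - x * p) - (2 * y * s - y * q)) =
      (x - y) * ((2 * x + y) * s - (x + y) * p)" .
qed

definition up_to :: "(nat \<times> nat) set \<Rightarrow> nat \<Rightarrow> (nat \<times> nat) set" where
  "up_to D n = {(r, c) \<in> D. c - r < n}"

definition diagonal :: "(nat \<times> nat) set \<Rightarrow> nat \<Rightarrow> (nat \<times> nat) set" where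
  "diagonal D n = {(r, c) \<in> D. c - r = n}"

lemma up_to_Suc: "up_to D (Suc n) = diagonal D n \<union> up_to D n"
  by (auto simp: up_to_def diagonal_def)

lemma finite_up_to: "finite D \<Longrightarrow> finite (up_to D n)"
  by (rule finite_subset[of _ D]) (auto simp: up_to_def)

lemma beyond_up_to:
  assumes "shifted_convex D" "(r, c) \<in> D"
  shows "beyond (up_to D (c - r)) r c"
  using assms shifted_convex_staircase by (auto simp: beyond_def up_to_def)

text \<open>
  The four cases are the possible sets of neighbours on the previous diagonal. Where there is
  exactly one neighbour, convexity makes it the only box of that diagonal: a second one would force
  either the other neighbour or another box on the current diagonal. The invariant can then be applied
  to it. In the other cases the symmetry of the earlier generating function suffices.
\<close>

lemma insert_one_symmetric:
  fixes x y :: "'a :: comm_ring_1"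
  assumes D: "shifted_convex D" "finite D" and b: "diagonal D n = {(r, c)}"
    and sym: "pair_gf i x y (up_to D n) = pair_gf i y x (up_to D n)"
    and bal: "\<And>m b. n = Suc m \<Longrightarrow> diagonal D m = {b} \<Longrightarrow> balanced i x y (up_to D n) b"
  shows "pair_gf i x y (insert (r, c) (up_to D n)) = pair_gf i y x (insert (r, c) (up_to D n))"
    and "balanced i x y (insert (r, c) (up_to D n)) (r, c)"
proof -
  let ?A = "up_to D n"
  let ?A' = "insert (r, c) ?A"
  from b have "(r, c) \<in> diagonal D n" by simp
  then have rc: "(r, c) \<in> D" "n = c - r" by (auto simp: diagonal_def)
  have le: "r \<le> c" using shifted_convex_staircase D(1) rc(1) by blast
  have only: "(r', c') = (r, c)" if "(r', c') \<in> D" "c' - r' = n" for r' c'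
    using that b by (auto simp: diagonal_def)
  have fin: "finite ?A" by (rule finite_up_to[OF D(2)])
  have bey: "beyond ?A r c" using beyond_up_to[OF D(1) rc(1)] rc(2) by simp
  have in_A: "(r', c') \<in> ?A \<longleftrightarrow> (r', c') \<in> D \<and> c' - r' < n" for r' c'
    by (simp add: up_to_def)
  consider (free) "\<And>c'. c = Suc c' \<Longrightarrow> (r, c') \<notin> ?A" "(Suc r, c) \<notin> ?A"
    | (right) d where "c = Suc d" "(r, d) \<in> ?A" "(Suc r, c) \<notin> ?A"
    | (up) "\<And>c'. c = Suc c' \<Longrightarrow> (r, c') \<notin> ?A" "(Suc r, c) \<in> ?A"
    | (corner) d where "c = Suc d" "(r, d) \<in> ?A" "(Suc r, c) \<in> ?A"
    by blast
  then have "pair_gf i x y ?A' = pair_gf i y x ?A' \<and> balanced i x y ?A' (r, c)"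
  proof cases
    case free
    show ?thesis
      using sym free unfolding balanced_def
      by (simp add: pair_gf_insert_free[OF fin bey]) (simp add: algebra_simps)
  next
    case (corner d)
    show ?thesis
      using sym unfolding corner(1) balanced_def
        pair_gf_insert_corner[OF fin bey[unfolded corner(1)] corner(2) corner(3)[unfolded corner(1)]]
      by (simp add: algebra_simps)
  next
    case (right d)
    have "diagonal D (d - r) = {(r, d)}"
    proof (intro equalityI subsetI)
      fix p assume "p \<in> diagonal D (d - r)"
      then obtain r' d' where p: "p = (r', d')" "(r', d') \<in> D" "d' - r' = d - r"
        by (auto simp: diagonal_def)
      have d: "(r, d) \<in> D" "r \<le> d" "r' \<le> d'"
        using right(2) p shifted_convex_staircase[OF D(1)] by (auto simp: in_A)
      show "p \<in> {(r, d)}"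
      proof (rule linorder_cases[of r' r])
        assume "r' < r"
        then have "(r - 1, d) \<in> D"
          using p(3) d by (intro shifted_convexD[OF D(1) p(2) d(1)]) auto
        with only[of "r - 1" d] \<open>r' < r\<close> right(1) rc(2) le d show ?thesis by auto
      next
        assume "r < r'"
        then have "(Suc r, Suc d) \<in> D"
          using p(3) d by (intro shifted_convexD[OF D(1) d(1) p(2)]) auto
        with right(1,3) rc(2) d show ?thesis by (auto simp: up_to_def Suc_diff_le)
      qed (use p d in auto)
    qed (use right in \<open>auto simp: in_A diagonal_def\<close>)
    moreover have "n = Suc (d - r)"
      using right(1,2) rc(2) shifted_convex_staircase[OF D(1), of r d]
      by (simp add: up_to_def Suc_diff_le)
    ultimately have bal: "balanced i x y ?A (r, d)" using bal by blast
    have bey: "beyond ?A r (Suc d)" and notB: "(Suc r, Suc d) \<notin> ?A" using bey right by auto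
    show ?thesis
      using right_step_algebra[OF bal[unfolded balanced_def]] sym
      unfolding right(1) balanced_def pair_gf_insert_right[OF fin bey right(2) notB] by simp
  next
    case up
    have "diagonal D (c - Suc r) = {(Suc r, c)}"
    proof (intro equalityI subsetI)
      fix p assume "p \<in> diagonal D (c - Suc r)"
      then obtain r' d' where p: "p = (r', d')" "(r', d') \<in> D" "d' - r' = c - Suc r"
        by (auto simp: diagonal_def)
      have d: "(Suc r, c) \<in> D" "Suc r \<le> c" "r' \<le> d'"
        using up(2) p shifted_convex_staircase[OF D(1)] by (auto simp: in_A)
      show "p \<in> {(Suc r, c)}"
      proof (rule linorder_cases[of r' "Suc r"])
        assume "r' < Suc r"
        then have "(r, c - 1) \<in> D"
          using p(3) d by (intro shifted_convexD[OF D(1) p(2) d(1)]) auto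
        moreover have "c - 1 - r < n" using d(2) rc(2) by simp
        ultimately show ?thesis using up(1)[of "c - 1"] d(2) by (simp add: in_A)
      next
        assume "Suc r < r'"
        then have "(Suc r, Suc c) \<in> D"
          using p(3) d by (intro shifted_convexD[OF D(1) d(1) p(2)]) auto
        with only[of "Suc r" "Suc c"] rc(2) show ?thesis by auto
      qed (use p d in auto)
    qed (use up in \<open>auto simp: in_A diagonal_def\<close>)
    moreover have "n = Suc (c - Suc r)"
      using up(2) rc(2) shifted_convex_staircase[OF D(1), of "Suc r" c]
      by (simp add: up_to_def Suc_diff_Suc)
    ultimately have bal: "balanced i x y ?A (Suc r, c)" using bal by blast
    have step: "pair_gf i u v ?A' = (2 * u + v) * pair_gf i u v ?A - (u + v) * pair_gf_at i u v ?A (Suc r, c)"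
      "pair_gf_at i u v ?A' (r, c) = 2 * u * pair_gf i u v ?A - u * pair_gf_at i u v ?A (Suc r, c)" for u v :: 'a
      using up by (auto intro: pair_gf_insert_up[OF fin bey])
    show ?thesis
      using up_step_algebra[OF bal[unfolded balanced_def]] sym
      unfolding balanced_def step by simp
  qed
  then show "pair_gf i x y ?A' = pair_gf i y x ?A'" "balanced i x y ?A' (r, c)" by blast+
qed


text \<open>
  Induction over the diagonals. By convexity the boxes of a diagonal are consecutive. A single box
  is handled by the previous analysis of its neighbours, two boxes contribute a multiple of the
  symmetric factor \<open>x * y\<close>, and three boxes leave no filling. After a diagonal with several
  boxes no balance is claimed: a single box on the next diagonal has two neighbours there, and its
  letter is then balanced whatever happened before.
\<close>

lemma pair_gf_up_to:
  fixes x y :: "'a :: comm_ring_1"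
  assumes D: "shifted_convex D" "finite D"
  shows "pair_gf i x y (up_to D n) = pair_gf i y x (up_to D n) \<and>
    (\<forall>m b. n = Suc m \<longrightarrow> diagonal D m = {b} \<longrightarrow> balanced i x y (up_to D n) b)"
proof (induction n)
  case 0
  then show ?case by (simp add: up_to_def pair_gf_def weight_def)
next
  case (Suc n)
  let ?A = "up_to D n"
  have sym: "pair_gf i x y ?A = pair_gf i y x ?A"
    and bal: "\<And>m b. n = Suc m \<Longrightarrow> diagonal D m = {b} \<Longrightarrow> balanced i x y ?A b"
    using Suc.IH by blast+
  have fin: "finite ?A" by (rule finite_up_to[OF D(2)])
  show ?case
  proof (cases "\<exists>b. diagonal D n \<subseteq> {b}")
    case True
    then consider "diagonal D n = {}" | r c where "diagonal D n = {(r, c)}"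
      by (metis subset_singletonD surj_pair)
    then show ?thesis
    proof cases
      case 1
      then show ?thesis using sym by (simp add: up_to_Suc)
    next
      case (2 r c)
      then show ?thesis
        using insert_one_symmetric[OF D 2 sym bal] by (simp add: up_to_Suc)
    qed
  next
    case False
    \<comment> \<open>The topmost box of the diagonal; a second and a third one must follow it directly.\<close>
    define r where "r = (LEAST r. (r, r + n) \<in> D)"
    have diag: "p \<in> diagonal D n \<longleftrightarrow> (\<exists>s. p = (s, s + n) \<and> (s, s + n) \<in> D)" for p
      using shifted_convex_staircase[OF D(1)] by (force simp: diagonal_def)
    obtain s where "(s, s + n) \<in> D"
      using False diag by blast
    then have r: "(r, r + n) \<in> D" and least: "\<And>s. (s, s + n) \<in> D \<Longrightarrow> r \<le> s"
      unfolding r_def by (auto intro: LeastI Least_le)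
    have down: "(t, t + n) \<in> D" if "(s, s + n) \<in> D" "r \<le> t" "t \<le> s" for s t
      using that by (intro shifted_convexD[OF D(1) r that(1)]) auto
    obtain s where s: "(s, s + n) \<in> D" "s \<noteq> r"
      using False diag by blast
    then have r2: "(Suc r, Suc (r + n)) \<in> D"
      using down[OF s(1), of "Suc r"] least[OF s(1)] by simp
    have multi: "diagonal D n \<noteq> {b}" for b
      using False by blast
    have "pair_gf i x y (up_to D (Suc n)) = pair_gf i y x (up_to D (Suc n))"
    proof (cases "(Suc (Suc r), Suc (Suc (r + n))) \<in> D")
      case True
      have "fillings i (up_to D (Suc n)) = {}"
        by (rule fillings_three_boxes[of r "r + n"]) (use r r2 True in \<open>auto simp: up_to_def\<close>)
      then show ?thesis by (simp add: pair_gf_def)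
    next
      case third: False
      have "s = r \<or> s = Suc r" if "(s, s + n) \<in> D" for s
        using third down[OF that, of "Suc (Suc r)"] least[OF that] by fastforce
      then have "diagonal D n = {(r, r + n), (Suc r, Suc (r + n))}"
        using r r2 by (force simp: diag)
      then have eq: "up_to D (Suc n) = insert (Suc r, Suc (r + n)) (insert (r, r + n) ?A)"
        by (auto simp: up_to_Suc)
      have bey: "beyond ?A r (r + n)"
        using beyond_up_to[OF D(1) r] by simp
      have "(Suc r, r + n) \<in> ?A" if "r < r + n"
        using shifted_convexD[OF D(1) r r2, of "Suc r" "r + n"] that by (simp add: up_to_def)
      from pair_gf_insert_two_boxes[OF fin bey this] obtain k where
        "pair_gf i u v (up_to D (Suc n)) = k * (u * v) * pair_gf i u v ?A" for u v :: 'a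
        unfolding eq by blast
      then show ?thesis using sym by (simp add: mult_ac)
    qed
    with multi show ?thesis by simp
  qed
qed

lemma pair_gf_symmetric:
  fixes x y :: "'a :: comm_ring_1"
  assumes D: "shifted_convex D" "finite D"
  shows "pair_gf i x y D = pair_gf i y x D"
proof -
  obtain n where "\<forall>k\<in>(\<lambda>(r, c). c - r) ` D. k < n"
    using finite_nat_set_iff_bounded finite_imageI[OF D(2)] by blast
  then have "up_to D n = D"
    by (auto simp: up_to_def)
  with pair_gf_up_to[OF D] show ?thesis by metis
qed

section \<open>Counting fillings with two letters\<close>

lemma wt_two_letters:
  assumes "finite D" "T \<in> fillings i D"
  shows "wt D T i + wt D T (Suc i) = card D"
proof -
  have "D = {b \<in> D. letter_index (T b) = i} \<union> {b \<in> D. letter_index (T b) = Suc i}"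
    using assms(2) by (auto simp: fillings_def pair_letters_def dest: PiE_mem)
  then have "card D = card ({b \<in> D. letter_index (T b) = i} \<union> {b \<in> D. letter_index (T b) = Suc i})"
    by simp
  also have "\<dots> = wt D T i + wt D T (Suc i)"
    unfolding wt_def using assms(1) by (intro card_Un_disjoint) auto
  finally show ?thesis by simp
qed

text \<open>
  The generating function is homogeneous, so one variable can be set to \<open>1\<close>; integer
  polynomials then allow single coefficients to be compared.
\<close>

lemma weight_x_one:
  assumes "finite D" "T \<in> fillings i D"
  shows "weight i [:0, 1:] 1 D T = (monom 1 (wt D T i) :: int poly)"
    and "weight i 1 [:0, 1:] D T = (monom 1 (wt D T (Suc i)) :: int poly)"
proof -
  have *: "(\<Prod>b\<in>D. if P b then [:0, 1:] else 1 :: int poly) = monom 1 (card {b \<in> D. P b})" for P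
    using assms(1) by (simp add: prod.inter_filter[symmetric] monom_altdef)
  have "weight i 1 [:0, 1:] D T =
      (\<Prod>b\<in>D. if letter_index (T b) = Suc i then [:0, 1:] else 1 :: int poly)"
    unfolding weight_def letter_weight_def using assms(2)
    by (intro prod.cong) (auto simp: fillings_def pair_letters_def dest: PiE_mem)
  with * show "weight i 1 [:0, 1:] D T = (monom 1 (wt D T (Suc i)) :: int poly)"
    by (simp add: wt_def)
  show "weight i [:0, 1:] 1 D T = (monom 1 (wt D T i) :: int poly)"
    unfolding weight_def letter_weight_def * wt_def ..
qed

lemma card_two_letter_fillings_symmetric:
  assumes D: "shifted_convex D" "finite D"
  shows "card {T \<in> fillings i D. wt D T i = a \<and> wt D T (Suc i) = b} =
    card {T \<in> fillings i D. wt D T i = b \<and> wt D T (Suc i) = a}"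
proof -
  have count: "coeff (\<Sum>T\<in>fillings i D. monom (1 :: int) (f T)) n =
      int (card {T \<in> fillings i D. f T = n})" for f n
    using finite_fillings[OF D(2), of i] by (simp add: coeff_sum sum.inter_filter[symmetric])
  have "(\<Sum>T\<in>fillings i D. monom (1 :: int) (wt D T i)) =
      (\<Sum>T\<in>fillings i D. monom 1 (wt D T (Suc i)))"
    using pair_gf_symmetric[OF D, of i "[:0, 1:] :: int poly" 1] weight_x_one[OF D(2)]
    by (simp add: pair_gf_def)
  then have marginal: "card {T \<in> fillings i D. wt D T i = a} = card {T \<in> fillings i D. wt D T (Suc i) = a}"
    using count[of "\<lambda>T. wt D T i" a] count[of "\<lambda>T. wt D T (Suc i)" a] by simp
  show ?thesis
  proof (cases "a + b = card D")
    case True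
    then have "{T \<in> fillings i D. wt D T i = a \<and> wt D T (Suc i) = b} = {T \<in> fillings i D. wt D T i = a}"
      "{T \<in> fillings i D. wt D T i = b \<and> wt D T (Suc i) = a} = {T \<in> fillings i D. wt D T (Suc i) = a}"
      using wt_two_letters[OF D(2)] by fastforce+
    with marginal show ?thesis by simp
  next
    case False
    then have "{T \<in> fillings i D. wt D T i = a \<and> wt D T (Suc i) = b} = {}"
      "{T \<in> fillings i D. wt D T i = b \<and> wt D T (Suc i) = a} = {}"
      using wt_two_letters[OF D(2)] by fastforce+
    then show ?thesis by (simp only:)
  qed
qed

section \<open>Convexity of skew shapes and of two-letter regions\<close>

lemma ShST_Q_eq: "ShST_Q lam mu = {T \<in> skew_boxes lam mu \<rightarrow>\<^sub>E letters. tableau (skew_boxes lam mu) T}"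
  by (simp add: ShST_Q_def tableau_def row_ok_def col_ok_def)

text \<open>
  Consecutive parts differ by at least one, which is what makes shifted rows end weakly further to
  the left as one goes down.
\<close>

lemma strict_partition_gap:
  assumes "strict_partition lam" "k + j < length lam"
  shows "lam ! (k + j) + j \<le> lam ! k"
  using assms(2)
proof (induction j)
  case (Suc j)
  have "lam ! Suc (k + j) < lam ! (k + j)"
    using assms(1) Suc.prems unfolding strict_partition_def
    by (intro sorted_wrt_nth_less[where P = "(>)"]) auto
  with Suc show ?case by simp
qed simp

lemma shifted_diagram_down_closed:
  assumes lam: "strict_partition lam" and b: "(r'', c'') \<in> shifted_diagram lam"
    and le: "1 \<le> r'" "r' \<le> r''" "r' \<le> c'" "c' \<le> c''"
  shows "(r', c') \<in> shifted_diagram lam"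
proof -
  have r: "r'' \<le> length lam" "c'' \<le> r'' + lam ! (r'' - 1) - 1"
    using b by (auto simp: shifted_diagram_def)
  have "lam ! (r' - 1 + (r'' - r')) + (r'' - r') \<le> lam ! (r' - 1)"
    using r le by (intro strict_partition_gap[OF lam]) simp
  moreover have "r' - 1 + (r'' - r') = r'' - 1" using le by simp
  ultimately have "c' \<le> r' + lam ! (r' - 1) - 1" using r le by simp
  then show ?thesis using r le by (simp add: shifted_diagram_def)
qed

lemma shifted_convex_skew_boxes:
  assumes "strict_partition lam" "strict_partition mu"
  shows "shifted_convex (skew_boxes lam mu)"
  unfolding shifted_convex_def
proof (intro conjI allI impI; (elim conjE)?)
  show "r \<le> c" if "(r, c) \<in> skew_boxes lam mu" for r c
    using that by (simp add: skew_boxes_def shifted_diagram_def)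
  fix r c r' c' r'' c''
  assume b: "(r, c) \<in> skew_boxes lam mu" "(r'', c'') \<in> skew_boxes lam mu"
    and le: "r \<le> r'" "r' \<le> r''" "c \<le> c'" "c' \<le> c''" "r' \<le> c'"
  have r: "1 \<le> r" "r \<le> c" using b(1) by (simp_all add: skew_boxes_def shifted_diagram_def)
  have "(r'', c'') \<in> shifted_diagram lam" using b(2) by (simp add: skew_boxes_def)
  then have "(r', c') \<in> shifted_diagram lam"
    by (rule shifted_diagram_down_closed[OF assms(1)]) (use r le in simp_all)
  moreover have "(r', c') \<notin> shifted_diagram mu"
  proof
    assume "(r', c') \<in> shifted_diagram mu"
    then have "(r, c) \<in> shifted_diagram mu"
      by (rule shifted_diagram_down_closed[OF assms(2)]) (use r le in simp_all)
    with b(1) show False by (simp add: skew_boxes_def)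
  qed
  ultimately show "(r', c') \<in> skew_boxes lam mu" by (simp add: skew_boxes_def)
qed

lemma tableau_index_mono:
  assumes "shifted_convex D" "tableau D T" "(r, c) \<in> D" "(s, d) \<in> D" "r \<le> s" "c \<le> d"
  shows "letter_index (T (r, c)) \<le> letter_index (T (s, d))"
proof -
  have "(r, d) \<in> D"
    using assms(5,6) shifted_convex_staircase[OF assms(1,3)]
    by (intro shifted_convexD[OF assms(1,3,4)]) auto
  have "letter_index (T (r, c)) \<le> letter_index (T (r, d))"
    using assms(2,3,6) \<open>(r, d) \<in> D\<close>
    by (cases "c = d") (auto simp: tableau_def row_ok_def intro: letter_index_mono)
  also have "\<dots> \<le> letter_index (T (s, d))"
    using assms(2,4,5) \<open>(r, d) \<in> D\<close>
    by (cases "r = s") (auto simp: tableau_def col_ok_def intro: letter_index_mono)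
  finally show ?thesis .
qed

definition two_letter_region :: "nat \<Rightarrow> (nat \<times> nat) set \<Rightarrow> (nat \<times> nat \<Rightarrow> letter) \<Rightarrow> (nat \<times> nat) set" where
  "two_letter_region i D T = {b \<in> D. T b \<in> pair_letters i}"

text \<open>
  Indices weakly increase downwards and to the right, so a box between two boxes of the region has
  an index between theirs.
\<close>

lemma shifted_convex_two_letter_region:
  assumes D: "shifted_convex D" and T: "tableau D T"
  shows "shifted_convex (two_letter_region i D T)"
  unfolding shifted_convex_def
proof (intro conjI allI impI; (elim conjE)?)
  show "r \<le> c" if "(r, c) \<in> two_letter_region i D T" for r c
    using that shifted_convex_staircase[OF D] by (simp add: two_letter_region_def)
  fix r c r' c' r'' c''
  assume b: "(r, c) \<in> two_letter_region i D T" "(r'', c'') \<in> two_letter_region i D T"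
    and le: "r \<le> r'" "r' \<le> r''" "c \<le> c'" "c' \<le> c''" "r' \<le> c'"
  have in_D: "(r, c) \<in> D" "(r'', c'') \<in> D" using b by (auto simp: two_letter_region_def)
  then have mid: "(r', c') \<in> D" using le by (rule shifted_convexD[OF D])
  have "letter_index (T (r, c)) \<le> letter_index (T (r', c'))"
    "letter_index (T (r', c')) \<le> letter_index (T (r'', c''))"
    using tableau_index_mono[OF D T] in_D mid le by auto
  then show "(r', c') \<in> two_letter_region i D T"
    using b mid by (auto simp: two_letter_region_def pair_letters_def)
qed

lemma tableau_subset: "tableau D T \<Longrightarrow> A \<subseteq> D \<Longrightarrow> tableau A T"
  unfolding tableau_def by blast

lemma tableau_cong: "tableau A T \<Longrightarrow> (\<And>b. b \<in> A \<Longrightarrow> U b = T b) \<Longrightarrow> tableau A U"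
  unfolding tableau_def by simp

lemma fillings_eq_tableau:
  assumes "shifted_convex A"
  shows "fillings i A = {T \<in> A \<rightarrow>\<^sub>E pair_letters i. tableau A T}"
proof -
  have "local_tableau A T \<longleftrightarrow> tableau A T" for T
    using local_tableau_imp_tableau[OF assms] tableau_imp_local_tableau[OF assms] by blast
  then show ?thesis by (simp add: fillings_def)
qed

lemma restrict_two_letter_region:
  assumes "shifted_convex D" "tableau D T"
  shows "restrict T (two_letter_region i D T) \<in> fillings i (two_letter_region i D T)"
proof -
  let ?A = "two_letter_region i D T"
  have "tableau ?A T"
    using assms(2) by (rule tableau_subset) (auto simp: two_letter_region_def)
  then have "tableau ?A (restrict T ?A)"
    by (rule tableau_cong) simp
  then show ?thesis
    unfolding fillings_eq_tableau[OF shifted_convex_two_letter_region[OF assms]]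
    by (auto simp: two_letter_region_def)
qed

lemma letter_index_override:
  assumes "U \<in> fillings i (two_letter_region i D T)" "b \<in> D"
  shows "letter_index (override_on T U (two_letter_region i D T) b) \<in> {i, Suc i} \<longleftrightarrow>
    b \<in> two_letter_region i D T"
  using assms by (auto simp: fillings_def override_on_def two_letter_region_def pair_letters_def dest!: PiE_mem)

text \<open>
  The boxes outside the region have indices below \<open>i\<close> or above \<open>Suc i\<close>, so every
  condition between inside and outside is a strict inequality of indices and does not depend on how
  the region is filled.
\<close>

lemma tableau_override:
  assumes D: "shifted_convex D" and T: "tableau D T"
    and U: "U \<in> fillings i (two_letter_region i D T)"
  shows "tableau D (override_on T U (two_letter_region i D T))"
proof -
  let ?A = "two_letter_region i D T" and ?V = "override_on T U (two_letter_region i D T)"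
  have tU: "tableau ?A U"
    using U fillings_eq_tableau[OF shifted_convex_two_letter_region[OF D T]] by auto
  have pair: "U b \<in> pair_letters i" if "b \<in> ?A" for b
    using U that by (auto simp: fillings_def)
  have mixed: "letter_index (?V (r, c)) < letter_index (?V (s, d))"
    if "(r, c) \<in> D" "(s, d) \<in> D" "r \<le> s" "c \<le> d" "((r, c) \<in> ?A) \<noteq> ((s, d) \<in> ?A)" for r c s d
    using tableau_index_mono[OF D T that(1-4)] that(1,2,5) pair[of "(r, c)"] pair[of "(s, d)"]
    by (auto simp: override_on_def two_letter_region_def pair_letters_def)
  show ?thesis
    unfolding tableau_def
  proof (intro conjI allI impI; elim conjE)
    fix r c d assume b: "(r, c) \<in> D" "(r, d) \<in> D" "c < d"
    show "row_ok (?V (r, c)) (?V (r, d))"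
    proof (cases "((r, c) \<in> ?A) = ((r, d) \<in> ?A)")
      case True
      then show ?thesis using b T tU by (auto simp: tableau_def override_on_def)
    next
      case False
      then show ?thesis using mixed[OF b(1,2)] b(3) by (intro row_ok_index_less) simp
    qed
  next
    fix r s c assume b: "(r, c) \<in> D" "(s, c) \<in> D" "r < s"
    show "col_ok (?V (r, c)) (?V (s, c))"
    proof (cases "((r, c) \<in> ?A) = ((s, c) \<in> ?A)")
      case True
      then show ?thesis using b T tU by (auto simp: tableau_def override_on_def)
    next
      case False
      then show ?thesis using mixed[OF b(1,2)] b(3) by (intro col_ok_index_less) simp
    qed
  qed
qed

lemma wt_override:
  assumes U: "U \<in> fillings i (two_letter_region i D T)"
  shows "j = i \<or> j = Suc i \<Longrightarrow> wt D (override_on T U (two_letter_region i D T)) j = wt (two_letter_region i D T) U j"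
    and "j \<noteq> i \<Longrightarrow> j \<noteq> Suc i \<Longrightarrow> wt D (override_on T U (two_letter_region i D T)) j = wt D T j"
proof -
  let ?A = "two_letter_region i D T" and ?V = "override_on T U (two_letter_region i D T)"
  note in_A = letter_index_override[OF U]
  have sub: "?A \<subseteq> D" by (auto simp: two_letter_region_def)
  show "wt D ?V j = wt ?A U j" if "j = i \<or> j = Suc i"
  proof -
    have "{b \<in> D. letter_index (?V b) = j} = {b \<in> ?A. letter_index (U b) = j}"
      using in_A that sub by (fastforce simp: override_on_def)
    then show ?thesis by (simp add: wt_def)
  qed
  show "wt D ?V j = wt D T j" if "j \<noteq> i" "j \<noteq> Suc i"
  proof -
    have "letter_index (?V b) = j \<longleftrightarrow> letter_index (T b) = j" if "b \<in> D" for b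
    proof (cases "b \<in> ?A")
      case True
      then show ?thesis
        using in_A[OF that] \<open>j \<noteq> i\<close> \<open>j \<noteq> Suc i\<close> by (auto simp: two_letter_region_def pair_letters_def)
    qed simp
    then have "{b \<in> D. letter_index (?V b) = j} = {b \<in> D. letter_index (T b) = j}"
      by blast
    then show ?thesis by (simp add: wt_def)
  qed
qed

section \<open>Exchanging the multiplicities of two consecutive letters\<close>

definition tableaux_of_weight :: "(nat \<times> nat) set \<Rightarrow> (nat \<Rightarrow> nat) \<Rightarrow> (nat \<times> nat \<Rightarrow> letter) set" where
  "tableaux_of_weight D w = {T \<in> D \<rightarrow>\<^sub>E letters. tableau D T \<and> wt D T = w}"

text \<open>
  The weight determines which indices occur.
\<close>

lemma finite_tableaux_of_weight:
  assumes "finite D"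
  shows "finite (tableaux_of_weight D w)"
proof (cases "tableaux_of_weight D w = {}")
  case False
  then obtain T0 where T0: "wt D T0 = w" by (auto simp: tableaux_of_weight_def)
  define K where "K = (\<lambda>a. letter_index (T0 a)) ` D"
  have "tableaux_of_weight D w \<subseteq> D \<rightarrow>\<^sub>E (Primed ` K \<union> Unprimed ` K)"
  proof
    fix T assume T: "T \<in> tableaux_of_weight D w"
    have "T b \<in> Primed ` K \<union> Unprimed ` K" if b: "b \<in> D" for b
    proof -
      let ?j = "letter_index (T b)"
      have "0 < wt D T ?j"
        unfolding wt_def card_gt_0_iff using b assms by (intro conjI) (blast, simp)
      then have "wt D T0 ?j \<noteq> 0" using T T0 by (simp add: tableaux_of_weight_def)
      then have "{a \<in> D. letter_index (T0 a) = ?j} \<noteq> {}"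
        unfolding wt_def by (metis card.empty)
      then obtain a where "a \<in> D" "letter_index (T0 a) = ?j" by blast
      then have "?j \<in> K" unfolding K_def by (metis imageI)
      then show ?thesis by (cases "T b") auto
    qed
    with T show "T \<in> D \<rightarrow>\<^sub>E (Primed ` K \<union> Unprimed ` K)"
      by (auto simp: tableaux_of_weight_def PiE_iff)
  qed
  moreover have "finite K" using assms by (simp add: K_def)
  ultimately show ?thesis
    by (rule_tac finite_subset) (use assms in \<open>auto intro!: finite_PiE\<close>)
qed simp

text \<open>
  For every convex region choose a bijection between its two-letter fillings with multiplicities
  \<open>(w i, w (Suc i))\<close> and those with the multiplicities exchanged. Applying it to the
  part of a tableau in the letters \<open>i\<close> and \<open>Suc i\<close> does not change the region of these
  letters. The region can thus be recovered from the image, and with it the tableau.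
\<close>

lemma card_tableaux_swap_le:
  assumes D: "shifted_convex D" "finite D" and i: "1 \<le> i"
  shows "card (tableaux_of_weight D w) \<le> card (tableaux_of_weight D (w \<circ> transpose i (Suc i)))"
proof -
  let ?F = "\<lambda>a b A. {U \<in> fillings i A. wt A U i = a \<and> wt A U (Suc i) = b}"
  let ?R = "two_letter_region i D"
  have "\<exists>\<phi>. bij_betw \<phi> (?F (w i) (w (Suc i)) A) (?F (w (Suc i)) (w i) A)"
    if "shifted_convex A" "finite A" for A
    by (rule finite_same_card_bij)
      (use card_two_letter_fillings_symmetric[OF that] finite_fillings[OF that(2)] in simp_all)
  then have "\<forall>A. \<exists>\<phi>. shifted_convex A \<and> finite A \<longrightarrow>
      bij_betw \<phi> (?F (w i) (w (Suc i)) A) (?F (w (Suc i)) (w i) A)"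
    by blast
  from choice[OF this] obtain \<phi> where \<phi>: "\<And>A. shifted_convex A \<Longrightarrow> finite A \<Longrightarrow>
      bij_betw (\<phi> A) (?F (w i) (w (Suc i)) A) (?F (w (Suc i)) (w i) A)"
    by blast
  define \<Phi> where "\<Phi> T = override_on T (\<phi> (?R T) (restrict T (?R T))) (?R T)" for T
  have region: "shifted_convex (?R T)" "finite (?R T)" "?R T \<subseteq> D"
    if "T \<in> tableaux_of_weight D w" for T
    using that shifted_convex_two_letter_region[OF D(1)] D(2)
    by (auto simp: tableaux_of_weight_def two_letter_region_def)
  have restr: "restrict T (?R T) \<in> ?F (w i) (w (Suc i)) (?R T)"
    if T: "T \<in> tableaux_of_weight D w" for T
  proof -
    have t: "tableau D T" "wt D T = w" using T by (auto simp: tableaux_of_weight_def)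
    note mem = restrict_two_letter_region[OF D(1) t(1), of i]
    have "override_on T (restrict T (?R T)) (?R T) = T"
      by (auto simp: override_on_def)
    then show ?thesis
      using mem wt_override(1)[OF mem, of i] wt_override(1)[OF mem, of "Suc i"] t(2) by auto
  qed
  have image: "\<phi> (?R T) (restrict T (?R T)) \<in> ?F (w (Suc i)) (w i) (?R T)"
    if "T \<in> tableaux_of_weight D w" for T
    using bij_betwE[OF \<phi>[OF region(1,2)[OF that]]] restr[OF that] by blast
  have same_region: "?R (\<Phi> T) = ?R T" if T: "T \<in> tableaux_of_weight D w" for T
  proof -
    have "\<phi> (?R T) (restrict T (?R T)) \<in> fillings i (?R T)" using image[OF T] by simp
    from letter_index_override[OF this]
    have "\<Phi> T b \<in> pair_letters i \<longleftrightarrow> b \<in> ?R T" if "b \<in> D" for b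
      using that by (simp add: \<Phi>_def pair_letters_def)
    with region(3)[OF T] show ?thesis
      by (subst two_letter_region_def) blast
  qed
  have "\<Phi> ` tableaux_of_weight D w \<subseteq> tableaux_of_weight D (w \<circ> transpose i (Suc i))"
  proof (intro subsetI, elim imageE, hypsubst)
    fix T assume T: "T \<in> tableaux_of_weight D w"
    then have t: "T \<in> D \<rightarrow>\<^sub>E letters" "tableau D T" "wt D T = w"
      by (auto simp: tableaux_of_weight_def)
    let ?U = "\<phi> (?R T) (restrict T (?R T))"
    have U: "?U \<in> fillings i (?R T)" "wt (?R T) ?U i = w (Suc i)" "wt (?R T) ?U (Suc i) = w i"
      using image[OF T] by auto
    have "pair_letters i \<subseteq> letters" using i by (auto simp: pair_letters_def letters_def)
    then have "\<Phi> T \<in> D \<rightarrow>\<^sub>E letters"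
      using t(1) U(1) region(3)[OF T]
      by (auto simp: \<Phi>_def override_on_def fillings_def PiE_iff extensional_def)
    moreover have "wt D (\<Phi> T) = w \<circ> transpose i (Suc i)"
    proof
      fix j
      show "wt D (\<Phi> T) j = (w \<circ> transpose i (Suc i)) j"
        using wt_override[OF U(1), of j] U(2,3) t(3)
        by (cases "j = i"; cases "j = Suc i") (auto simp: \<Phi>_def)
    qed
    ultimately show "\<Phi> T \<in> tableaux_of_weight D (w \<circ> transpose i (Suc i))"
      using tableau_override[OF D(1) t(2) U(1)] by (simp add: tableaux_of_weight_def \<Phi>_def)
  qed
  moreover have "inj_on \<Phi> (tableaux_of_weight D w)"
  proof (rule inj_onI)
    fix T T' assume T: "T \<in> tableaux_of_weight D w" and T': "T' \<in> tableaux_of_weight D w"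
      and eq: "\<Phi> T = \<Phi> T'"
    have R: "?R T' = ?R T" using same_region[OF T] same_region[OF T'] eq by simp
    let ?f = "\<lambda>T. \<phi> (?R T) (restrict T (?R T))"
    have "?f T b = ?f T' b" for b
    proof (cases "b \<in> ?R T")
      case True
      then show ?thesis using fun_cong[OF eq, of b] R by (simp add: \<Phi>_def)
    next
      case False
      then show ?thesis using image[OF T] image[OF T'] R
        by (cases b) (auto simp: fillings_def PiE_iff extensional_def)
    qed
    then have "\<phi> (?R T) (restrict T (?R T)) = \<phi> (?R T) (restrict T' (?R T))"
      using R by auto
    then have "restrict T (?R T) = restrict T' (?R T)"
      using bij_betw_imp_inj_on[OF \<phi>[OF region(1,2)[OF T]]] restr[OF T] restr[OF T'] R
      by (auto dest: inj_onD)
    then have inside: "T b = T' b" if "b \<in> ?R T" for b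
      using that by (metis restrict_apply')
    have outside: "T b = T' b" if "b \<notin> ?R T" for b
      using fun_cong[OF eq, of b] that R by (simp add: \<Phi>_def)
    show "T = T'" using inside outside by blast
  qed
  ultimately show ?thesis
    using finite_tableaux_of_weight[OF D(2)] by (intro card_inj_on_le)
qed

lemma card_tableaux_swap:
  assumes D: "shifted_convex D" "finite D" and i: "1 \<le> i"
  shows "card (tableaux_of_weight D (w \<circ> transpose i (Suc i))) = card (tableaux_of_weight D w)"
proof (rule antisym)
  have "(w \<circ> transpose i (Suc i)) \<circ> transpose i (Suc i) = w"
    by (simp add: fun_eq_iff)
  then show "card (tableaux_of_weight D (w \<circ> transpose i (Suc i))) \<le> card (tableaux_of_weight D w)"
    using card_tableaux_swap_le[OF assms, of "w \<circ> transpose i (Suc i)"] by simp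
qed (rule card_tableaux_swap_le[OF assms])

section \<open>Arbitrary permutations of the variables\<close>

text \<open>
  Conjugation by the transposition of two neighbours moves one end of a transposition by one step.
\<close>

lemma card_tableaux_transpose:
  assumes D: "shifted_convex D" "finite D" and a: "1 \<le> a"
  shows "card (tableaux_of_weight D (w \<circ> transpose a (Suc a + k))) = card (tableaux_of_weight D w)"
proof (induction k arbitrary: w)
  case 0
  show ?case using card_tableaux_swap[OF assms] by (simp only: add_0_right)
next
  case (Suc k)
  let ?b = "Suc a + k"
  have "transpose ?b (Suc ?b) \<circ> transpose a ?b \<circ> transpose ?b (Suc ?b) = transpose a (Suc ?b)"
    using transpose_comp_triple[of "Suc ?b" a ?b] by (simp add: transpose_commute)
  then have eq: "w \<circ> transpose a (Suc ?b) =
      ((w \<circ> transpose ?b (Suc ?b)) \<circ> transpose a ?b) \<circ> transpose ?b (Suc ?b)"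
    by (simp add: comp_assoc)
  have "1 \<le> ?b" by simp
  then show ?case
    by (simp only: add_Suc_right eq card_tableaux_swap[OF D] Suc.IH)
qed

lemma card_tableaux_finite_permutation:
  assumes D: "shifted_convex D" "finite D" and F: "finite F" "F \<subseteq> {1..}" and \<tau>: "\<tau> permutes F"
  shows "card (tableaux_of_weight D (w \<circ> \<tau>)) = card (tableaux_of_weight D w)"
  using F(1) \<tau>
proof (induction arbitrary: w rule: permutes_rev_induct)
  case id
  show ?case by simp
next
  case (swap a b p)
  have "card (tableaux_of_weight D (v \<circ> transpose a b)) = card (tableaux_of_weight D v)" for v
  proof (cases "a < b")
    case True
    then show ?thesis
      using card_tableaux_transpose[OF D, of a v "b - Suc a"] swap(1) F(2) by auto
  next
    case False
    with swap(3) have "b < a" by simp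
    then show ?thesis
      using card_tableaux_transpose[OF D, of b v "a - Suc b"] swap(2) F(2)
      by (auto simp: transpose_commute)
  qed
  from this[of "w \<circ> p"] swap.IH show ?case by (simp only: comp_assoc)
qed

text \<open>
  A permutation of the variables may move infinitely many of them, but only its values on the
  preimage of the support of \<open>w\<close> matter. There it is a bijection between two finite sets, and
  it extends to a permutation of their union.
\<close>

lemma finite_permutation_on_support:
  fixes w :: "nat \<Rightarrow> nat"
  assumes \<sigma>: "\<sigma> permutes {1..}" and w: "finite {j. w j \<noteq> 0}"
  obtains \<tau> F where "finite F" "F \<subseteq> {1..}" "\<tau> permutes F" "w \<circ> \<sigma> = w \<circ> \<tau>"
proof -
  define K where "K = {j. w j \<noteq> 0} - {0}"
  define K' where "K' = \<sigma> -` K"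
  have bij: "bij \<sigma>" using \<sigma> by (rule permutes_bij)
  have \<sigma>0: "\<sigma> 0 = 0" using \<sigma> by (simp add: permutes_not_in)
  have \<sigma>_nonzero: "\<sigma> j \<noteq> 0" if "j \<noteq> 0" for j
    using that permutes_in_image[OF \<sigma>, of j] by auto
  have "finite K" using w by (simp add: K_def)
  moreover from this have "finite K'"
    unfolding K'_def by (rule finite_vimageI) (rule bij_is_inj[OF bij])
  ultimately have K: "finite K" "finite K'" .
  have \<sigma>K: "bij_betw \<sigma> K' K"
    unfolding K'_def
    by (rule bij_betw_subset[OF bij subset_UNIV surj_image_vimage_eq[OF bij_is_surj[OF bij]]])
  define F where "F = K \<union> K'"
  have F: "finite F" "F \<subseteq> {1..}" "K \<subseteq> F" "K' \<subseteq> F"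
    using K \<sigma>0 by (auto simp: F_def K_def K'_def Suc_le_eq intro!: gr0I)
  have "card (F - K') = card (F - K)"
    using F K bij_betw_same_card[OF \<sigma>K] by (simp add: card_Diff_subset)
  then obtain g where g: "bij_betw g (F - K') (F - K)"
    using finite_same_card_bij[of "F - K'" "F - K"] F(1) by blast
  define \<tau> where "\<tau> j = (if j \<in> K' then \<sigma> j else if j \<in> F then g j else j)" for j
  have "bij_betw \<tau> K' K"
    using \<sigma>K by (rule bij_betw_cong[THEN iffD1, rotated]) (simp add: \<tau>_def)
  moreover have "bij_betw \<tau> (F - K') (F - K)"
    using g by (rule bij_betw_cong[THEN iffD1, rotated]) (simp add: \<tau>_def)
  ultimately have "bij_betw \<tau> (K' \<union> (F - K')) (K \<union> (F - K))"
    by (rule bij_betw_combine) auto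
  then have "bij_betw \<tau> F F" using F(3,4) by (simp add: Un_absorb1)
  then have \<tau>: "\<tau> permutes F"
    by (rule bij_imp_permutes) (use F(4) in \<open>auto simp: \<tau>_def\<close>)
  have "w (\<sigma> j) = w (\<tau> j)" for j
  proof -
    consider "j \<in> K'" | "j \<in> F - K'" | "j \<notin> F" "j \<noteq> 0" | "j = 0"
      by blast
    then show ?thesis
    proof cases
      case 2
      then have "g j \<in> F - K" using bij_betwE[OF g] by blast
      moreover have "\<sigma> j \<notin> K" "\<sigma> j \<noteq> 0"
        using 2 F(2) \<sigma>_nonzero[of j] by (auto simp: K'_def)
      ultimately show ?thesis
        using 2 F(2) by (auto simp: \<tau>_def K_def)
    next
      case 3
      then show ?thesis
        using F(4) \<sigma>_nonzero[of j] by (auto simp: \<tau>_def F_def K_def K'_def)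
    next
      case 4
      have "0 \<notin> F" using F(2) by auto
      then show ?thesis
        using 4 F(4) \<sigma>0 by (auto simp: \<tau>_def)
    qed (simp add: \<tau>_def)
  qed
  then have "w \<circ> \<sigma> = w \<circ> \<tau>" by (simp add: fun_eq_iff)
  with F \<tau> show ?thesis using that by blast
qed

theorem corollary7p6:
  fixes lam mu :: "nat list"
  assumes "shifted_skew_shape lam mu"
  shows "symmetric_series (schur_Q lam mu)"
  unfolding symmetric_series_def
proof (intro allI impI)
  fix \<sigma> :: "nat \<Rightarrow> nat" assume \<sigma>: "\<sigma> permutes {1..}"
  let ?D = "skew_boxes lam mu"
  have D: "shifted_convex ?D" "finite ?D"
    using assms shifted_convex_skew_boxes finite_skew_boxes unfolding shifted_skew_shape_def
    by blast+
  have Q: "schur_Q lam mu \<alpha> = int (card (tableaux_of_weight ?D (Poly_Mapping.lookup \<alpha>)))" for \<alpha>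
    by (simp only: schur_Q_def ShST_Q_eq tableaux_of_weight_def mem_Collect_eq conj_assoc)
  have inj: "inj \<sigma>" using \<sigma> by (rule permutes_inj)
  show "permute_variables \<sigma> (schur_Q lam mu) = schur_Q lam mu"
  proof
    fix \<beta> :: "nat \<Rightarrow>\<^sub>0 nat"
    obtain \<tau> F where \<tau>: "finite F" "F \<subseteq> {1..}" "\<tau> permutes F" "Poly_Mapping.lookup \<beta> \<circ> \<sigma> = Poly_Mapping.lookup \<beta> \<circ> \<tau>"
      by (rule finite_permutation_on_support[OF \<sigma> finite_lookup[of \<beta>]])
    have "Poly_Mapping.lookup (Poly_Mapping.map_key \<sigma> \<beta>) = Poly_Mapping.lookup \<beta> \<circ> \<tau>"
      by (simp only: map_key.rep_eq[OF inj] \<tau>(4))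
    then show "permute_variables \<sigma> (schur_Q lam mu) \<beta> = schur_Q lam mu \<beta>"
      by (simp only: permute_variables_def Q card_tableaux_finite_permutation[OF D \<tau>(1-3)])
  qed
qed

end
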